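(* There is an absolute constant $C>0$ such that the following holds. Let $L>0$, $n\ge 1$, and let $f(\cdot;1),\dots,f(\cdot;n):\mathbb{R}^d\to\mathbb{R}$ be convex differentiable functions such that $\|\nabla f(x;i)-\nabla f(y;i)\|\le L\|x-y\|$ for all $x,y\in\mathbb{R}^d$ and $i\in\{1,\dots,n\}$. Let $F(w)=\frac1n\sum_{i=1}^n f(w;i)$, assume $F$ has a minimizer, let $x_*$ be any minimizer of $F$, and let $\sigma_*^2=\frac1n\sum_{i=1}^n\|\nabla f(x_*;i)\|^2$. Let $\epsilon>0$ and let $\tilde x_0\in\mathbb{R}^d$ be deterministic. Then the number $nT$ of individual gradient evaluations needed by the NASG algorithm started at $\tilde y_0=\tilde x_0$ under a randomized scheme (Random Reshuffling or Single Shuffling), with $\gamma_t=\frac{t-1}{t+2}$, $\eta_i^{(t)}=\frac{\eta_t}{n}$, $\eta_t=\frac{k\alpha^t}{LT}\le\frac1L$, $k=\frac{1}{e\alpha\sqrt[3]{12}}$, $\alpha=1+\frac1T$, to reach a point $x$ with $\mathbb{E}[F(x)-F(x_* )]\le\epsilon$ is $$nT=\mathcal{O}\left(\frac{\sigma_*^2}{L\epsilon}+\frac{nL\|\tilde x_0-x_*\|^2}{\epsilon}\right),$$ in the sense that whenever the number of epochs is an integer $T\ge 2$ with $nT\ge C\left(\frac{\sigma_*^2}{L\epsilon}+\frac{nL\|\tilde x_0-x_*\|^2}{\epsilon}\right)$, the output satisfies $\mathbb{E}[F(\tilde x_T)-F(x_* )]\le\epsilon$.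
   Context: NASG (Nesterov Accelerated Shuffling Gradient) algorithm: given initial points $\tilde x_0,\tilde y_0\in\mathbb{R}^d$, parameters $\gamma_t$ and learning rates $\eta_i^{(t)}>0$, for each epoch $t=1,2,\dots,T$: set $y_0^{(t)}:=\tilde y_{t-1}$; choose a permutation $\pi^{(t)}$ of $\{1,\dots,n\}$; for $i=1,\dots,n$ set $y_i^{(t)}:=y_{i-1}^{(t)}-\eta_i^{(t)}\nabla f(y_{i-1}^{(t)};\pi^{(t)}(i))$; then set $\tilde x_t:=y_n^{(t)}$ and $\tilde y_t:=\tilde x_t+\gamma_t(\tilde x_t-\tilde x_{t-1})$. The algorithm uses $n$ individual gradient evaluations per epoch, hence $nT$ in total. Randomized schemes: Random Reshuffling means a new uniformly random permutation $\pi^{(t)}$ is drawn independently at the beginning of each epoch; Single Shuffling means a single uniformly random permutation is drawn at the start and used in every epoch. $\mathbb{E}$ is the expectation over the random permutation(s); $e$ is Euler's number. *)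

theory Defs
  imports "HOL-Probability.Probability" "HOL-Library.Poly_Mapping"
begin

section \<open>Euclidean spaces of arbitrary dimension inside one type\<close>

text \<open>
  The constant in the theorem must not depend on the dimension, so the dimension has to be
  quantified inside the formula and cannot be encoded in a type such as \<open>real ^ 'd\<close>.
  We therefore realise every Euclidean space \<open>\<real>\<^sup>d\<close> as a subspace of the inner product space
  of finitely supported real sequences.
\<close>

instantiation poly_mapping :: (type, real_vector) real_vector
begin

lift_definition scaleR_poly_mapping :: "real \<Rightarrow> ('a \<Rightarrow>\<^sub>0 'b) \<Rightarrow> 'a \<Rightarrow>\<^sub>0 'b"
  is "\<lambda>r x i. r *\<^sub>R x i"
  by (rule finite_subset[rotated]) auto

instance
  by standard (transfer, simp add: algebra_simps fun_eq_iff)+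

end

lemma lookup_scaleR [simp]: "Poly_Mapping.lookup (r *\<^sub>R x) i = r *\<^sub>R Poly_Mapping.lookup x i"
  by transfer simp

instantiation poly_mapping :: (type, real_inner) real_inner
begin

definition inner_poly_mapping :: "('a \<Rightarrow>\<^sub>0 'b) \<Rightarrow> ('a \<Rightarrow>\<^sub>0 'b) \<Rightarrow> real"
  where "x \<bullet> y = (\<Sum>i\<in>Poly_Mapping.keys x. Poly_Mapping.lookup x i \<bullet> Poly_Mapping.lookup y i)"

definition norm_poly_mapping :: "('a \<Rightarrow>\<^sub>0 'b) \<Rightarrow> real"
  where "norm_poly_mapping x = sqrt (x \<bullet> x)"

definition sgn_poly_mapping :: "('a \<Rightarrow>\<^sub>0 'b) \<Rightarrow> 'a \<Rightarrow>\<^sub>0 'b"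
  where "sgn_poly_mapping x = inverse (norm x) *\<^sub>R x"

definition dist_poly_mapping :: "('a \<Rightarrow>\<^sub>0 'b) \<Rightarrow> ('a \<Rightarrow>\<^sub>0 'b) \<Rightarrow> real"
  where "dist_poly_mapping x y = norm (x - y)"

definition uniformity_poly_mapping :: "(('a \<Rightarrow>\<^sub>0 'b) \<times> ('a \<Rightarrow>\<^sub>0 'b)) filter"
  where "uniformity_poly_mapping = (INF e\<in>{0<..}. principal {(x, y). dist x y < e})"

definition open_poly_mapping :: "('a \<Rightarrow>\<^sub>0 'b) set \<Rightarrow> bool"
  where "open_poly_mapping U \<longleftrightarrow> (\<forall>x\<in>U. \<forall>\<^sub>F (x', y) in uniformity. x' = x \<longrightarrow> y \<in> U)"

lemma inner_poly_mapping_superset: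
  fixes x y :: "'a \<Rightarrow>\<^sub>0 'b"
  assumes "finite A" "Poly_Mapping.keys x \<subseteq> A"
  shows "x \<bullet> y = (\<Sum>i\<in>A. Poly_Mapping.lookup x i \<bullet> Poly_Mapping.lookup y i)"
  unfolding inner_poly_mapping_def using assms
  by (intro sum.mono_neutral_left) (auto simp: in_keys_iff)

instance
proof
  fix x y z :: "'a \<Rightarrow>\<^sub>0 'b" and r :: real
  show "x \<bullet> y = y \<bullet> x"
    by (simp add: inner_poly_mapping_superset[of "Poly_Mapping.keys x \<union> Poly_Mapping.keys y"] inner_commute)
  show "(x + y) \<bullet> z = x \<bullet> z + y \<bullet> z"
    using Poly_Mapping.keys_add[of x y]
    by (simp add: inner_poly_mapping_superset[of "Poly_Mapping.keys x \<union> Poly_Mapping.keys y"] lookup_add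
        inner_add_left sum.distrib)
  have "Poly_Mapping.keys (r *\<^sub>R x) \<subseteq> Poly_Mapping.keys x"
    by (auto simp: in_keys_iff)
  then show "(r *\<^sub>R x) \<bullet> y = r * (x \<bullet> y)"
    by (simp add: inner_poly_mapping_superset[of "Poly_Mapping.keys x"] sum_distrib_left)
  show "0 \<le> x \<bullet> x"
    by (simp add: inner_poly_mapping_def sum_nonneg)
  have "x \<bullet> x = 0 \<longleftrightarrow> (\<forall>i\<in>Poly_Mapping.keys x. Poly_Mapping.lookup x i = 0)"
    by (simp add: inner_poly_mapping_def sum_nonneg_eq_0_iff)
  also have "\<dots> \<longleftrightarrow> Poly_Mapping.keys x = {}"
    by (auto simp: in_keys_iff simp del: keys_eq_empty)
  finally show "x \<bullet> x = 0 \<longleftrightarrow> x = 0"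
    by simp
qed (rule norm_poly_mapping_def sgn_poly_mapping_def dist_poly_mapping_def
    uniformity_poly_mapping_def open_poly_mapping_def)+

end

type_synonym fsvec = "nat \<Rightarrow>\<^sub>0 real"

definition Rd :: "nat \<Rightarrow> fsvec set"
  where "Rd d = {x. Poly_Mapping.keys x \<subseteq> {..<d}}"

lemma Rd_iff: "x \<in> Rd d \<longleftrightarrow> (\<forall>i\<ge>d. Poly_Mapping.lookup x i = 0)"
  unfolding Rd_def by (metis in_keys_iff lessThan_iff mem_Collect_eq not_le subsetD subsetI)

lemma inner_Rd: "x \<in> Rd d \<Longrightarrow> x \<bullet> y = (\<Sum>i<d. Poly_Mapping.lookup x i * Poly_Mapping.lookup y i)"
  by (simp add: Rd_def inner_poly_mapping_superset[of "{..<d}"])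

lemma norm_Rd: "x \<in> Rd d \<Longrightarrow> norm x = sqrt (\<Sum>i<d. (Poly_Mapping.lookup x i)\<^sup>2)"
  by (simp add: norm_eq_sqrt_inner inner_Rd power2_eq_square)

lemma subspace_Rd: "subspace (Rd d)"
  by (simp add: subspace_def Rd_iff lookup_add)

section \<open>Gradients\<close>

text \<open>
  For \<open>f\<close> differentiable at \<open>x\<close> within \<open>\<real>\<^sup>d\<close> such a vector exists and is unique (see the lemmas
  below); the values of \<open>f\<close> outside \<open>\<real>\<^sup>d\<close> are irrelevant.
\<close>

definition grad :: "nat \<Rightarrow> (fsvec \<Rightarrow> real) \<Rightarrow> fsvec \<Rightarrow> fsvec"
  where "grad d f x =
    (THE g. g \<in> Rd d \<and> (f has_derivative (\<lambda>h. g \<bullet> h)) (at x within Rd d))"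

lemma grad_unique:
  assumes "x \<in> Rd d" "g \<in> Rd d" "g' \<in> Rd d"
    and "(f has_derivative (\<lambda>h. g \<bullet> h)) (at x within Rd d)"
    and "(f has_derivative (\<lambda>h. g' \<bullet> h)) (at x within Rd d)"
  shows "g = g'"
proof (rule ccontr)
  assume ne: "g \<noteq> g'"
  define v where "v = g - g'"
  have v: "v \<in> Rd d" "v \<noteq> 0"
    using subspace_diff[OF subspace_Rd assms(2,3)] ne by (auto simp: v_def)
  let ?c = "\<lambda>t::real. x + t *\<^sub>R v"
  have c: "(?c has_derivative (\<lambda>t. t *\<^sub>R v)) (at 0)"
    by (auto intro!: derivative_eq_intros)
  have sub: "?c ` UNIV \<subseteq> Rd d"
    using assms(1) v subspace_Rd by (auto intro: subspace_add subspace_scale)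
  have *: "((\<lambda>t. f (?c t)) has_derivative (\<lambda>t. u \<bullet> (t *\<^sub>R v))) (at 0)"
    if "(f has_derivative (\<lambda>h. u \<bullet> h)) (at x within Rd d)" for u
    using diff_chain_within[of ?c "\<lambda>t. t *\<^sub>R v" 0 UNIV f "\<lambda>h. u \<bullet> h"] c
      has_derivative_subset[OF _ sub, of f "\<lambda>h. u \<bullet> h" x] that
    by (simp add: o_def)
  have "(\<lambda>t::real. g \<bullet> (t *\<^sub>R v)) = (\<lambda>t. g' \<bullet> (t *\<^sub>R v))"
    using *[OF assms(4)] *[OF assms(5)] by (rule has_derivative_unique)
  then have "v \<bullet> v = 0"
    by (auto simp: v_def inner_diff_left dest!: fun_cong[of _ _ 1])
  with v show False by simp
qed

lemma grad_works:
  assumes x: "x \<in> Rd d" and f: "f differentiable (at x within Rd d)"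
  shows "grad d f x \<in> Rd d"
    and "(f has_derivative (\<lambda>h. grad d f x \<bullet> h)) (at x within Rd d)"
proof -
  from f obtain D where D: "(f has_derivative D) (at x within Rd d)"
    unfolding differentiable_def by blast
  then interpret D: bounded_linear D
    by (rule has_derivative_bounded_linear)
  define g where "g = (\<Sum>i<d. Poly_Mapping.single i (D (Poly_Mapping.single i 1)))"
  have lookup_g: "Poly_Mapping.lookup g i = (if i < d then D (Poly_Mapping.single i 1) else 0)" for i
    by (auto simp: g_def lookup_sum lookup_single when_def)
  then have g: "g \<in> Rd d"
    by (auto simp: Rd_def in_keys_iff split: if_splits)
  have D_eq: "D h = g \<bullet> h" if h: "h \<in> Rd d" for h
  proof -
    have h0: "Poly_Mapping.lookup h j = 0" if "\<not> j < d" for j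
      using h that by (auto simp: Rd_def in_keys_iff)
    have "h = (\<Sum>i<d. Poly_Mapping.lookup h i *\<^sub>R Poly_Mapping.single i 1)"
      by (rule poly_mapping_eqI)
        (auto simp: lookup_sum lookup_single when_def h0 if_distrib cong: if_cong)
    then have "D h = D (\<Sum>i<d. Poly_Mapping.lookup h i *\<^sub>R Poly_Mapping.single i 1)"
      by (rule arg_cong)
    also have "\<dots> = (\<Sum>i<d. Poly_Mapping.lookup h i * D (Poly_Mapping.single i 1))"
      by (simp add: D.sum D.scaleR)
    also have "\<dots> = g \<bullet> h"
      by (simp add: inner_Rd[OF g] lookup_g mult.commute)
    finally show ?thesis .
  qed
  have "(f has_derivative (\<lambda>h. g \<bullet> h)) (at x within Rd d)"
    unfolding has_derivative_within
  proof (intro conjI bounded_linear_inner_right)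
    have "((\<lambda>y. (1 / norm (y - x)) *\<^sub>R (f y - (f x + D (y - x)))) \<longlongrightarrow> 0) (at x within Rd d)"
      using D by (simp add: has_derivative_within)
    then show "((\<lambda>y. (1 / norm (y - x)) *\<^sub>R (f y - (f x + g \<bullet> (y - x)))) \<longlongrightarrow> 0)
        (at x within Rd d)"
      by (rule Lim_transform_eventually)
        (auto simp: eventually_at_filter D_eq subspace_diff[OF subspace_Rd _ x])
  qed
  with g have "\<exists>!g. g \<in> Rd d \<and> (f has_derivative (\<lambda>h. g \<bullet> h)) (at x within Rd d)"
    using grad_unique[OF x] by blast
  from theI'[OF this] show "grad d f x \<in> Rd d"
    and "(f has_derivative (\<lambda>h. grad d f x \<bullet> h)) (at x within Rd d)"
    unfolding grad_def by auto
qed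

section \<open>Finite-sum objective\<close>

definition avg_fun :: "nat \<Rightarrow> (nat \<Rightarrow> fsvec \<Rightarrow> real) \<Rightarrow> fsvec \<Rightarrow> real"
  where "avg_fun n f w = (1 / real n) * (\<Sum>i=1..n. f i w)"

definition sigma_sq :: "nat \<Rightarrow> nat \<Rightarrow> (nat \<Rightarrow> fsvec \<Rightarrow> real) \<Rightarrow> fsvec \<Rightarrow> real"
  where "sigma_sq d n f x = (1 / real n) * (\<Sum>i=1..n. (norm (grad d (f i) x))\<^sup>2)"

section \<open>The NASG algorithm\<close>

text \<open>
  In \<open>nasg_inner g \<eta> \<pi> y i\<close>, \<open>g j\<close> is the gradient of the \<open>j\<close>-th component and \<open>\<eta>\<close>, \<open>\<pi>\<close> are the
  learning rates and the permutation of the current epoch, which starts at \<open>y\<close>. The pair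
  \<open>nasg n g \<gamma> \<eta> \<pi> x0 y0 t\<close> consists of the two iterates with a tilde after epoch \<open>t\<close>; the first
  argument of \<open>\<eta>\<close> and \<open>\<pi>\<close> is the epoch.
\<close>

primrec nasg_inner ::
  "(nat \<Rightarrow> 'a \<Rightarrow> 'a) \<Rightarrow> (nat \<Rightarrow> real) \<Rightarrow> (nat \<Rightarrow> nat) \<Rightarrow> 'a \<Rightarrow> nat \<Rightarrow> 'a::real_vector"
where
  "nasg_inner g \<eta> \<pi> y 0 = y"
| "nasg_inner g \<eta> \<pi> y (Suc i) =
    nasg_inner g \<eta> \<pi> y i - \<eta> (Suc i) *\<^sub>R g (\<pi> (Suc i)) (nasg_inner g \<eta> \<pi> y i)"

primrec nasg ::
  "nat \<Rightarrow> (nat \<Rightarrow> 'a \<Rightarrow> 'a) \<Rightarrow> (nat \<Rightarrow> real) \<Rightarrow> (nat \<Rightarrow> nat \<Rightarrow> real) \<Rightarrow> (nat \<Rightarrow> nat \<Rightarrow> nat)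
    \<Rightarrow> 'a \<Rightarrow> 'a \<Rightarrow> nat \<Rightarrow> 'a \<times> 'a::real_vector"
where
  "nasg n g \<gamma> \<eta> \<pi> x0 y0 0 = (x0, y0)"
| "nasg n g \<gamma> \<eta> \<pi> x0 y0 (Suc t) =
    (let (x, y) = nasg n g \<gamma> \<eta> \<pi> x0 y0 t;
         x' = nasg_inner g (\<eta> (Suc t)) (\<pi> (Suc t)) y n
     in (x', x' + \<gamma> (Suc t) *\<^sub>R (x' - x)))"

text \<open>Distributions of the permutations of epochs \<open>1, \<dots>, T\<close>.\<close>

definition random_reshuffling :: "nat \<Rightarrow> nat \<Rightarrow> (nat \<Rightarrow> nat \<Rightarrow> nat) pmf"
  where "random_reshuffling n T = Pi_pmf {1..T} id (\<lambda>_. pmf_of_set {p. p permutes {1..n}})"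

definition single_shuffling :: "nat \<Rightarrow> (nat \<Rightarrow> nat \<Rightarrow> nat) pmf"
  where "single_shuffling n = map_pmf (\<lambda>p t. p) (pmf_of_set {p. p permutes {1..n}})"

section \<open>Parameter choice\<close>

definition nasg_alpha :: "nat \<Rightarrow> real"
  where "nasg_alpha T = 1 + 1 / real T"

definition nasg_k :: "nat \<Rightarrow> real"
  where "nasg_k T = 1 / (exp 1 * nasg_alpha T * root 3 12)"

definition nasg_eta :: "real \<Rightarrow> nat \<Rightarrow> nat \<Rightarrow> real"
  where "nasg_eta L T t = nasg_k T * nasg_alpha T ^ t / (L * real T)"

definition nasg_gamma :: "nat \<Rightarrow> real"
  where "nasg_gamma t = (real t - 1) / (real t + 2)"

end

theory Submission
  imports Defs
begin

text \<open>
  Summing the three-point inequality for smooth convex functions over an epoch bounds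
  \<open>F(x')\<close> by \<open>F(u)\<close>, a linear term in the mean \<open>G\<close> of the gradients used, and the squared
  distances of the inner iterates from \<open>x'\<close>. For \<open>u\<close> the minimizer \<open>x\<^sub>*\<close> there is also a co-coercivity
  gain; as the step sizes are of order \<open>1 / (L T)\<close>, it absorbs these distances up to the norms of
  tail sums of the permuted gradients \<open>\<nabla>f(x\<^sub>*; \<pi>(j))\<close>. The usual potential
  \<open>t (t + 2) / 4 * (F(x\<^sub>t) - F(x\<^sub>*)) + \<parallel>z\<^sub>t - x\<^sub>*\<parallel>\<^sup>2 / (2 \<eta>)\<close> of Nesterov's method therefore grows per
  epoch only by a multiple of this noise. The gradients at \<open>x\<^sub>*\<close> sum to zero, so distinct
  samples without replacement are nonpositively correlated and the expected noise is at most
  \<open>\<sigma>\<^sub>*\<^sup>2 / n\<close>. Only the distribution of each single permutation enters, not their joint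
  distribution, which is why both schemes are covered.
\<close>

section \<open>Smooth convex functions on a subspace\<close>

text \<open>The whole line stays in \<open>S\<close>, so the derivative within \<open>S\<close>
  becomes an ordinary derivative in one real variable, to which monotonicity and extremum arguments
  apply.\<close>

lemma has_real_derivative_along_line:
  fixes f :: "'a::real_inner \<Rightarrow> real"
  assumes S: "subspace S" and "w \<in> S" "v \<in> S"
    and deriv: "\<And>x. x \<in> S \<Longrightarrow> (f has_derivative (\<lambda>h. g x \<bullet> h)) (at x within S)"
  shows "((\<lambda>t. f (w + t *\<^sub>R v)) has_real_derivative g (w + t *\<^sub>R v) \<bullet> v) (at t)"
proof -
  let ?c = "\<lambda>t::real. w + t *\<^sub>R v"
  have c: "(?c has_derivative (\<lambda>t. t *\<^sub>R v)) (at t)"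
    by (auto intro!: derivative_eq_intros)
  have mem: "?c s \<in> S" for s
    using assms by (auto intro: subspace_add subspace_scale)
  then have "range ?c \<subseteq> S" by auto
  from has_derivative_subset[OF deriv[OF mem] this]
  have "((\<lambda>t. f (?c t)) has_derivative (\<lambda>s. g (?c t) \<bullet> (s *\<^sub>R v))) (at t)"
    using diff_chain_within[OF c] by (fastforce simp: o_def)
  then show ?thesis
    by (simp add: has_field_derivative_def mult.commute[of "g (?c t) \<bullet> v"] mult_commute_abs)
qed

text \<open>Convexity bounds the difference quotients from \<open>w\<close> towards \<open>u\<close>
  by \<open>f u - f w\<close>; their right-hand limit is the directional derivative.\<close>

lemma convex_on_subspace_above_tangent:
  fixes f :: "'a::real_inner \<Rightarrow> real"
  assumes S: "subspace S" and w: "w \<in> S" and u: "u \<in> S"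
    and deriv: "\<And>x. x \<in> S \<Longrightarrow> (f has_derivative (\<lambda>h. g x \<bullet> h)) (at x within S)"
    and conv: "convex_on S f"
  shows "f w + g w \<bullet> (u - w) \<le> f u"
proof -
  let ?c = "\<lambda>t::real. w + t *\<^sub>R (u - w)"
  have v: "u - w \<in> S" using S u w by (rule subspace_diff)
  have "((\<lambda>t. f (?c t)) has_real_derivative g w \<bullet> (u - w)) (at 0)"
    using has_real_derivative_along_line[OF S w v deriv, of 0] by simp
  then have lim: "((\<lambda>h. (f (?c h) - f w) / h) \<longlongrightarrow> g w \<bullet> (u - w)) (at_right 0)"
    unfolding DERIV_def by (rule_tac filterlim_mono[OF _ order_refl at_le]) auto
  have "\<forall>\<^sub>F h in at_right 0. (f (?c h) - f w) / h \<le> f u - f w"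
    unfolding eventually_at_right_field
  proof (intro exI[of _ 1] conjI allI impI)
    fix h :: real assume h: "0 < h" "h < 1"
    have "?c h = (1 - h) *\<^sub>R w + h *\<^sub>R u" by (simp add: algebra_simps)
    with convex_onD[OF conv, of h w u] h u w
    have "f (?c h) \<le> (1 - h) * f w + h * f u" by simp
    with h show "(f (?c h) - f w) / h \<le> f u - f w" by (simp add: field_simps)
  qed simp
  from tendsto_upperbound[OF lim this] show ?thesis by simp
qed

text \<open>Subtracting the linear and quadratic terms from \<open>f\<close> along the segment
  leaves a function whose derivative is nonpositive by Cauchy-Schwarz. No integration is
  involved.\<close>

lemma lipschitz_gradient_upper_bound:
  fixes f :: "'a::real_inner \<Rightarrow> real"
  assumes S: "subspace S" and w: "w \<in> S" and x: "x \<in> S"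
    and deriv: "\<And>x. x \<in> S \<Longrightarrow> (f has_derivative (\<lambda>h. g x \<bullet> h)) (at x within S)"
    and lip: "\<And>x y. x \<in> S \<Longrightarrow> y \<in> S \<Longrightarrow> norm (g x - g y) \<le> L * norm (x - y)"
  shows "f x \<le> f w + g w \<bullet> (x - w) + L / 2 * (norm (x - w))\<^sup>2"
proof -
  let ?v = "x - w"
  let ?c = "\<lambda>t::real. w + t *\<^sub>R ?v"
  let ?p = "\<lambda>t. f (?c t) - t * (g w \<bullet> ?v) - L / 2 * t\<^sup>2 * (norm ?v)\<^sup>2"
  have v: "?v \<in> S" using S x w by (rule subspace_diff)
  have "?p 1 \<le> ?p 0"
  proof (rule DERIV_nonpos_imp_nonincreasing[of 0 1 ?p])
    fix t :: real assume t: "0 \<le> t" "t \<le> 1"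
    let ?D = "g (?c t) \<bullet> ?v - g w \<bullet> ?v - L * t * (norm ?v)\<^sup>2"
    have d: "(?p has_real_derivative ?D) (at t)"
      by (auto intro!: derivative_eq_intros has_real_derivative_along_line[OF S w v deriv])
    have "?c t \<in> S" using S w v by (auto intro: subspace_add subspace_scale)
    then have "norm (g (?c t) - g w) \<le> L * t * norm ?v"
      using lip[of "?c t" w] w t by simp
    then have "(g (?c t) - g w) \<bullet> ?v \<le> L * t * norm ?v * norm ?v"
      by (meson norm_cauchy_schwarz mult_right_mono norm_ge_zero order_trans)
    then have "?D \<le> 0" by (simp add: inner_diff_left power2_eq_square)
    with d show "\<exists>y. (?p has_real_derivative y) (at t) \<and> y \<le> 0" by blast
  qed simp
  then show ?thesis by simp
qed

text \<open>At a third point \<open>z\<close>, the tangent at \<open>w\<close> lies below the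
  quadratic upper bound at \<open>u\<close>. A good choice of \<open>z\<close> turns this into the
  co-coercivity gain.\<close>

lemma smooth_convex_lower_bound:
  fixes f :: "'a::real_inner \<Rightarrow> real"
  assumes S: "subspace S" and w: "w \<in> S" and u: "u \<in> S" and L: "L > 0"
    and deriv: "\<And>x. x \<in> S \<Longrightarrow> (f has_derivative (\<lambda>h. g x \<bullet> h)) (at x within S)"
    and mem: "\<And>x. x \<in> S \<Longrightarrow> g x \<in> S"
    and lip: "\<And>x y. x \<in> S \<Longrightarrow> y \<in> S \<Longrightarrow> norm (g x - g y) \<le> L * norm (x - y)"
    and conv: "convex_on S f"
  shows "f w + g w \<bullet> (u - w) + (norm (g u - g w))\<^sup>2 / (2 * L) \<le> f u"
proof -
  let ?e = "g u - g w"
  \<comment> \<open>This \<open>z\<close> minimizes the quadratic upper bound at \<open>u\<close>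
    minus the tangent at \<open>w\<close>.\<close>
  define z where "z = u - (1 / L) *\<^sub>R ?e"
  have z: "z \<in> S"
    unfolding z_def using S u w mem by (auto intro!: subspace_diff subspace_scale)
  have "norm (z - u) = norm ?e / L"
    using L by (simp add: z_def)
  then have q: "L / 2 * (norm (z - u))\<^sup>2 = (norm ?e)\<^sup>2 / (2 * L)"
    using L by (simp add: power2_eq_square)
  have "f w + g w \<bullet> (z - w) \<le> f u + g u \<bullet> (z - u) + L / 2 * (norm (z - u))\<^sup>2"
    using convex_on_subspace_above_tangent[OF S w z deriv conv]
      lipschitz_gradient_upper_bound[OF S u z deriv lip] by linarith
  moreover have "g w \<bullet> (z - w) = g w \<bullet> (u - w) + g w \<bullet> (z - u)"
    by (simp add: algebra_simps)
  moreover have "g u \<bullet> (z - u) - g w \<bullet> (z - u) = - ((norm ?e)\<^sup>2 / L)"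
    by (simp add: z_def power2_norm_eq_inner inner_diff_left diff_divide_distrib)
  moreover have "(norm ?e)\<^sup>2 / L = (norm ?e)\<^sup>2 / (2 * L) + (norm ?e)\<^sup>2 / (2 * L)"
    using L by (simp add: field_simps)
  ultimately show ?thesis using q by linarith
qed

text \<open>Upper bound from \<open>w\<close> to \<open>x\<close> plus lower bound from
  \<open>w\<close> to \<open>u\<close>; the value \<open>f w\<close> cancels. This allows a gradient
  taken at an inner iterate \<open>w\<close> to compare the end \<open>x\<close> of the epoch with a
  reference point \<open>u\<close>.\<close>

lemma smooth_convex_three_points:
  fixes f :: "'a::real_inner \<Rightarrow> real"
  assumes S: "subspace S" and w: "w \<in> S" and u: "u \<in> S" and x: "x \<in> S" and L: "L > 0"
    and deriv: "\<And>x. x \<in> S \<Longrightarrow> (f has_derivative (\<lambda>h. g x \<bullet> h)) (at x within S)"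
    and mem: "\<And>x. x \<in> S \<Longrightarrow> g x \<in> S"
    and lip: "\<And>x y. x \<in> S \<Longrightarrow> y \<in> S \<Longrightarrow> norm (g x - g y) \<le> L * norm (x - y)"
    and conv: "convex_on S f"
  shows "f x \<le> f u + g w \<bullet> (x - u) + L / 2 * (norm (x - w))\<^sup>2 - (norm (g w - g u))\<^sup>2 / (2 * L)"
proof -
  have "g w \<bullet> (x - w) - g w \<bullet> (u - w) = g w \<bullet> (x - u)"
    by (simp add: algebra_simps)
  then show ?thesis
    using lipschitz_gradient_upper_bound[OF S w x deriv lip]
      smooth_convex_lower_bound[OF S w u L deriv mem lip conv] norm_minus_commute[of "g u" "g w"]
    by simp
qed

lemma gradient_minimizer_eq_0:
  fixes f :: "'a::real_inner \<Rightarrow> real"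
  assumes S: "subspace S" and x: "x \<in> S" "g x \<in> S"
    and deriv: "\<And>x. x \<in> S \<Longrightarrow> (f has_derivative (\<lambda>h. g x \<bullet> h)) (at x within S)"
    and min: "\<And>y. y \<in> S \<Longrightarrow> f x \<le> f y"
  shows "g x = 0"
proof -
  let ?c = "\<lambda>t::real. x + t *\<^sub>R g x"
  have d: "((\<lambda>t. f (?c t)) has_real_derivative g x \<bullet> g x) (at 0)"
    using has_real_derivative_along_line[OF S x deriv, of 0] by simp
  have "f (?c 0) \<le> f (?c t)" for t
    using min[of "?c t"] x S by (auto intro: subspace_add subspace_scale)
  then have "g x \<bullet> g x = 0"
    using DERIV_local_min[OF d, of 1] by auto
  then show ?thesis by simp
qed

section \<open>Sampling without replacement\<close>

abbreviation uniform_permutation :: "'b set \<Rightarrow> ('b \<Rightarrow> 'b) pmf"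
  where "uniform_permutation S \<equiv> pmf_of_set {p. p permutes S}"

lemma permutes_nonempty: "{p. p permutes S} \<noteq> {}"
  using permutes_id[of S] by blast

lemma set_uniform_permutation [simp]:
  "finite S \<Longrightarrow> set_pmf (uniform_permutation S) = {p. p permutes S}"
  by (rule set_pmf_of_set[OF permutes_nonempty finite_permutations])

lemma integrable_uniform_permutation [simp, intro]:
  fixes f :: "('b \<Rightarrow> 'b) \<Rightarrow> real"
  shows "finite S \<Longrightarrow> integrable (uniform_permutation S) f"
  by (rule integrable_measure_pmf_finite) (simp add: finite_permutations)

lemma expectation_uniform_permutation_compose:
  fixes f :: "('b \<Rightarrow> 'b) \<Rightarrow> real"
  assumes "finite S" "q permutes S"
  shows "measure_pmf.expectation (uniform_permutation S) (\<lambda>p. f (p \<circ> q)) =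
    measure_pmf.expectation (uniform_permutation S) f"
  using sum_permutations_compose_right[OF assms(2), of f] assms(1)
  by (simp add: integral_pmf_of_set[OF permutes_nonempty finite_permutations])

text \<open>Composing with a transposition shows that all positions have the same expectation, and
  the sum over all positions is the constant \<open>\<Sum>j\<in>S. b j\<close>.\<close>

lemma expectation_permuted_value:
  fixes b :: "'b \<Rightarrow> real"
  assumes S: "finite S" and i: "i \<in> S"
  shows "measure_pmf.expectation (uniform_permutation S) (\<lambda>p. b (p i)) = (\<Sum>j\<in>S. b j) / real (card S)"
    (is "?E i = _")
proof -
  have "?E j = ?E i" if "j \<in> S" for j
    using expectation_uniform_permutation_compose[OF S permutes_swap_id[OF that i], of "\<lambda>p. b (p i)"]
    by simp
  then have "real (card S) * ?E i = (\<Sum>j\<in>S. ?E j)" by simp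
  also have "\<dots> = measure_pmf.expectation (uniform_permutation S) (\<lambda>p. \<Sum>j\<in>S. b (p j))"
    using S by (intro Bochner_Integration.integral_sum[symmetric]) auto
  also have "\<dots> = measure_pmf.expectation (uniform_permutation S) (\<lambda>p. \<Sum>j\<in>S. b j)"
  proof (rule integral_cong_AE)
    show "AE p in uniform_permutation S. (\<Sum>j\<in>S. b (p j)) = (\<Sum>j\<in>S. b j)"
      using S by (auto simp: AE_measure_pmf_iff sum.permute[of _ _ b] o_def)
  qed auto
  finally have "real (card S) * ?E i = (\<Sum>j\<in>S. b j)" by simp
  moreover have "card S > 0" using S i by (auto simp: card_gt_0_iff)
  ultimately show ?thesis by (simp add: field_simps)
qed

text \<open>By symmetry every position \<open>k \<noteq> i\<close> gives the same expectation. Since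
  the vectors sum to zero, the sum over these \<open>k\<close> is minus the squared norm of
  \<open>a (p i)\<close>.\<close>

lemma expectation_permuted_inner_nonpos:
  fixes a :: "'b \<Rightarrow> 'a::real_inner"
  assumes S: "finite S" and zero: "(\<Sum>j\<in>S. a j) = 0"
    and i: "i \<in> S" and j: "j \<in> S" and ne: "i \<noteq> j"
  shows "measure_pmf.expectation (uniform_permutation S) (\<lambda>p. a (p i) \<bullet> a (p j)) \<le> 0"
    (is "?E j \<le> 0")
proof -
  have eq: "?E k = ?E j" if k: "k \<in> S - {i}" for k
  proof -
    have "k \<in> S" "k \<noteq> i" using k by auto
    then show ?thesis
      using expectation_uniform_permutation_compose[OF S permutes_swap_id[OF _ j, of k],
          of "\<lambda>p. a (p i) \<bullet> a (p j)"] ne by (simp add: transpose_apply_other)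
  qed
  have "real (card (S - {i})) * ?E j = (\<Sum>k\<in>S-{i}. ?E k)"
    using eq by simp
  also have "\<dots> = measure_pmf.expectation (uniform_permutation S)
      (\<lambda>p. \<Sum>k\<in>S-{i}. a (p i) \<bullet> a (p k))"
    using S by (intro Bochner_Integration.integral_sum[symmetric]) auto
  also have "\<dots> \<le> measure_pmf.expectation (uniform_permutation S) (\<lambda>p. 0)"
  proof (rule integral_mono_AE)
    have "(\<Sum>k\<in>S-{i}. a (p i) \<bullet> a (p k)) \<le> 0" if "p permutes S" for p
    proof -
      have "(\<Sum>k\<in>S. a (p k)) = 0"
        using zero sum.permute[OF that, of a] by (simp add: o_def)
      then have "(\<Sum>k\<in>S-{i}. a (p k)) = - a (p i)"
        using S i by (simp add: sum_diff1)
      then have "(\<Sum>k\<in>S-{i}. a (p i) \<bullet> a (p k)) = - (a (p i) \<bullet> a (p i))"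
        by (simp flip: inner_sum_right)
      then show ?thesis by simp
    qed
    then show "AE p in uniform_permutation S. (\<Sum>k\<in>S-{i}. a (p i) \<bullet> a (p k)) \<le> 0"
      using S by (auto simp: AE_measure_pmf_iff)
  qed (use S in auto)
  finally have "real (card (S - {i})) * ?E j \<le> 0" by simp
  moreover have "card (S - {i}) > 0" using S j ne by (auto simp: card_gt_0_iff)
  ultimately show ?thesis by (simp add: mult_le_0_iff)
qed

lemma expectation_permuted_partial_sum:
  fixes a :: "'b \<Rightarrow> 'a::real_inner"
  assumes S: "finite S" and zero: "(\<Sum>j\<in>S. a j) = 0" and A: "A \<subseteq> S"
  shows "measure_pmf.expectation (uniform_permutation S) (\<lambda>p. (norm (\<Sum>j\<in>A. a (p j)))\<^sup>2)
    \<le> (\<Sum>j\<in>S. (norm (a j))\<^sup>2)"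
proof (cases "S = {}")
  case True
  with A show ?thesis by simp
next
  case False
  let ?U = "uniform_permutation S" and ?s = "\<Sum>j\<in>S. (norm (a j))\<^sup>2"
  have fin: "finite A" using A S finite_subset by blast
  have "measure_pmf.expectation ?U (\<lambda>p. (norm (\<Sum>j\<in>A. a (p j)))\<^sup>2) =
    measure_pmf.expectation ?U (\<lambda>p. \<Sum>i\<in>A. \<Sum>j\<in>A. a (p i) \<bullet> a (p j))"
    unfolding power2_norm_eq_inner inner_sum_left inner_sum_right by (subst sum.swap) (rule refl)
  also have "\<dots> = (\<Sum>i\<in>A. \<Sum>j\<in>A. measure_pmf.expectation ?U (\<lambda>p. a (p i) \<bullet> a (p j)))"
    using S by (simp add: Bochner_Integration.integral_sum)
  \<comment> \<open>Off-diagonal expectations are nonpositive, and each diagonal one is the mean of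
    the squared norms.\<close>
  also have "\<dots> \<le> (\<Sum>i\<in>A. \<Sum>j\<in>A. if j = i then ?s / real (card S) else 0)"
  proof (intro sum_mono)
    fix i j assume ij: "i \<in> A" "j \<in> A"
    show "measure_pmf.expectation ?U (\<lambda>p. a (p i) \<bullet> a (p j))
        \<le> (if j = i then ?s / real (card S) else 0)"
      using expectation_permuted_inner_nonpos[OF S zero, of i j]
        expectation_permuted_value[OF S, of i "\<lambda>j. a j \<bullet> a j"] ij A
      by (auto simp: power2_norm_eq_inner)
  qed
  also have "\<dots> = real (card A) * (?s / real (card S))"
    using fin by simp
  also have "\<dots> \<le> real (card S) * (?s / real (card S))"
    using card_mono[OF S A] by (intro mult_right_mono) (auto simp: sum_nonneg)
  finally show ?thesis using False S by simp
qed

text \<open>The inner iterate \<open>i - 1\<close> differs from the end of the epoch by the steps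
  \<open>i..n\<close>. With gradients frozen at the minimizer and unit epoch step, this is the mean
  squared length of those differences.\<close>

definition tail_noise :: "nat \<Rightarrow> (nat \<Rightarrow> 'a::real_normed_vector) \<Rightarrow> (nat \<Rightarrow> nat) \<Rightarrow> real"
  where "tail_noise n a p = (\<Sum>i=1..n. (norm ((\<Sum>j=i..n. a (p j)) /\<^sub>R real n))\<^sup>2) / real n"

lemma tail_noise_nonneg: "tail_noise n a p \<ge> 0"
  by (simp add: tail_noise_def sum_nonneg)

lemma expectation_tail_noise:
  fixes a :: "nat \<Rightarrow> 'a::real_inner"
  assumes zero: "(\<Sum>j=1..n. a j) = 0"
  shows "measure_pmf.expectation (uniform_permutation {1..n}) (tail_noise n a)
    \<le> (\<Sum>j=1..n. (norm (a j))\<^sup>2) / (real n)\<^sup>2"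
proof (cases "n = 0")
  case True
  then show ?thesis by (simp add: tail_noise_def[abs_def])
next
  case False
  let ?U = "uniform_permutation {1..n}" and ?s = "\<Sum>j=1..n. (norm (a j))\<^sup>2"
  have "tail_noise n a = (\<lambda>p. \<Sum>i=1..n. (norm (\<Sum>j=i..n. a (p j)))\<^sup>2 / (real n) ^ 3)"
    by (simp add: fun_eq_iff tail_noise_def power_mult_distrib sum_divide_distrib
        power_divide power3_eq_cube power2_eq_square field_simps)
  then have "measure_pmf.expectation ?U (tail_noise n a) =
      (\<Sum>i=1..n. measure_pmf.expectation ?U (\<lambda>p. (norm (\<Sum>j=i..n. a (p j)))\<^sup>2) / (real n) ^ 3)"
    by (simp add: Bochner_Integration.integral_sum)
  also have "\<dots> \<le> (\<Sum>i=1..n. ?s / (real n) ^ 3)"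
    by (intro sum_mono divide_right_mono expectation_permuted_partial_sum zero) auto
  also have "\<dots> = ?s / (real n)\<^sup>2"
    using False by (simp add: power3_eq_cube power2_eq_square)
  finally show ?thesis .
qed

text \<open>The common interface of both schemes: finite support gives integrability, the uniform
  marginals give the expected noise of an epoch, and the support property makes the pathwise bounds
  applicable.\<close>

lemma randomized_scheme:
  assumes "P \<in> {random_reshuffling n T, single_shuffling n}"
  shows finite_set_scheme: "finite (set_pmf P)"
    and scheme_marginal: "t \<in> {1..T} \<Longrightarrow> map_pmf (\<lambda>\<pi>. \<pi> t) P = uniform_permutation {1..n}"
    and scheme_permutes: "\<pi> \<in> set_pmf P \<Longrightarrow> t \<in> {1..T} \<Longrightarrow> \<pi> t permutes {1..n}"
proof -
  show "finite (set_pmf P)"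
    using assms by (auto simp: random_reshuffling_def single_shuffling_def set_Pi_pmf
        finite_permutations intro!: finite_PiE_dflt)
  show marginal: "map_pmf (\<lambda>\<pi>. \<pi> t) P = uniform_permutation {1..n}" if "t \<in> {1..T}" for t
    using assms that by (auto simp: random_reshuffling_def single_shuffling_def Pi_pmf_component
        map_pmf_comp)
  show "\<pi> t permutes {1..n}" if "\<pi> \<in> set_pmf P" "t \<in> {1..T}"
    using that arg_cong[OF marginal[OF that(2)], of set_pmf] by auto
qed

section \<open>Descent of the potential\<close>

lemma nasg_inner_eq:
  "nasg_inner g \<eta> \<pi> y i = y - (\<Sum>j=1..i. \<eta> j *\<^sub>R g (\<pi> j) (nasg_inner g \<eta> \<pi> y (j - 1)))"
  by (induction i) (simp_all add: algebra_simps)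

lemma norm_sum_squared_le:
  fixes h :: "'b \<Rightarrow> 'a::real_normed_vector"
  shows "(norm (\<Sum>i\<in>I. h i))\<^sup>2 \<le> real (card I) * (\<Sum>i\<in>I. (norm (h i))\<^sup>2)"
proof -
  have "(norm (\<Sum>i\<in>I. h i))\<^sup>2 \<le> (\<Sum>i\<in>I. norm (h i))\<^sup>2"
    by (intro power_mono norm_sum norm_ge_zero)
  also have "\<dots> \<le> (\<Sum>i\<in>I. (norm (h i))\<^sup>2) * real (card I)"
    by (rule sum_squared_le_sum_of_squares)
  finally show ?thesis by (simp add: mult.commute)
qed

lemma norm_add_squared_le:
  fixes a b :: "'a::real_inner"
  shows "(norm (a + b))\<^sup>2 \<le> 2 * (norm a)\<^sup>2 + 2 * (norm b)\<^sup>2"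
proof -
  have "2 * (norm a)\<^sup>2 + 2 * (norm b)\<^sup>2 - (norm (a + b))\<^sup>2 = (norm (a - b))\<^sup>2"
    by (simp add: power2_norm_eq_inner inner_add_left inner_add_right inner_diff_left
        inner_diff_right inner_commute)
  then show ?thesis by (smt (verit) zero_le_power2)
qed

section \<open>The finite-sum problem and the analysis of one epoch\<close>

locale smooth_convex_sum =
  fixes S :: "'a::real_inner set" and n :: nat and L :: real
    and f :: "nat \<Rightarrow> 'a \<Rightarrow> real" and g :: "nat \<Rightarrow> 'a \<Rightarrow> 'a" and xs :: 'a
  assumes S: "subspace S" and n: "n \<ge> 1" and L: "L > 0"
    and conv: "i \<in> {1..n} \<Longrightarrow> convex_on S (f i)"
    and deriv: "i \<in> {1..n} \<Longrightarrow> x \<in> S \<Longrightarrow> (f i has_derivative (\<lambda>h. g i x \<bullet> h)) (at x within S)"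
    and grad_mem: "i \<in> {1..n} \<Longrightarrow> x \<in> S \<Longrightarrow> g i x \<in> S"
    and lip: "i \<in> {1..n} \<Longrightarrow> x \<in> S \<Longrightarrow> y \<in> S \<Longrightarrow> norm (g i x - g i y) \<le> L * norm (x - y)"
    and xs: "xs \<in> S"
    and minimizer: "x \<in> S \<Longrightarrow> (\<Sum>i=1..n. f i xs) \<le> (\<Sum>i=1..n. f i x)"
begin

text \<open>This is \<open>F(x) - F(xs)\<close>, written termwise so that inequalities for the
  single components can be summed in permuted order.\<close>

definition gap :: "'a \<Rightarrow> real"
  where "gap x = (\<Sum>i=1..n. f i x - f i xs) / real n"

lemma gap_nonneg: "x \<in> S \<Longrightarrow> gap x \<ge> 0"
  using minimizer by (simp add: gap_def sum_subtractf)

text \<open>First-order optimality of the full sum; it supplies the zero-sum condition for sampling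
  without replacement.\<close>

lemma sum_gradients_minimizer: "(\<Sum>i=1..n. g i xs) = 0"
proof (rule gradient_minimizer_eq_0[OF S xs, where f = "\<lambda>x. \<Sum>i=1..n. f i x"])
  show "(\<Sum>i=1..n. g i xs) \<in> S"
    using S grad_mem xs by (intro subspace_sum) auto
  show "((\<lambda>x. \<Sum>i=1..n. f i x) has_derivative (\<bullet>) (\<Sum>i=1..n. g i x)) (at x within S)"
    if "x \<in> S" for x
    unfolding inner_sum_left using deriv that by (intro has_derivative_sum) auto
qed (use minimizer in auto)

lemma nasg_inner_mem:
  assumes "y \<in> S" "p permutes {1..n}" "i \<le> n"
  shows "nasg_inner g \<eta> p y i \<in> S"
  using assms(3)
proof (induction i)
  case (Suc i)
  then have "p (Suc i) \<in> {1..n}" using permutes_in_image[OF assms(2), of "Suc i"] by simp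
  with Suc show ?case using S by (auto intro!: subspace_diff subspace_scale grad_mem)
qed (use assms in simp)

text \<open>The gradients are taken at the moving inner iterates, so a whole epoch acts as one
  inexact gradient step of length \<open>\<eta>\<close> from \<open>y\<close>.\<close>

definition epoch_gradient :: "real \<Rightarrow> (nat \<Rightarrow> nat) \<Rightarrow> 'a \<Rightarrow> 'a"
  where "epoch_gradient \<eta> p y =
    (\<Sum>i=1..n. g (p i) (nasg_inner g (\<lambda>_. \<eta> / real n) p y (i - 1))) /\<^sub>R real n"

lemma nasg_inner_epoch: "nasg_inner g (\<lambda>_. \<eta> / real n) p y n = y - \<eta> *\<^sub>R epoch_gradient \<eta> p y"
  by (subst nasg_inner_eq) (simp add: epoch_gradient_def scaleR_sum_right divide_inverse)

text \<open>The displacement is \<open>- \<eta>\<close> times the normalized tail sum of gradients.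
  It splits into deviations from the gradients at \<open>xs\<close>, controlled by \<open>Q\<close>,
  and the gradients at \<open>xs\<close> themselves, whose squared tails average to
  \<open>tail_noise\<close>.\<close>

lemma epoch_displacement:
  fixes \<eta> p y
  defines "w \<equiv> nasg_inner g (\<lambda>_. \<eta> / real n) p y"
  defines "Q \<equiv> (\<Sum>i=1..n. (norm (g (p i) (w (i - 1)) - g (p i) xs))\<^sup>2) / real n"
  shows "(\<Sum>i=1..n. (norm (w n - w (i - 1)))\<^sup>2) / real n
    \<le> 2 * \<eta>\<^sup>2 * (Q + tail_noise n (\<lambda>i. g i xs) p)"
proof -
  define e where "e j = g (p j) (w (j - 1)) - g (p j) xs" for j
  let ?B = "\<lambda>i. (\<Sum>j=i..n. g (p j) xs) /\<^sub>R real n"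
  have "(norm (w n - w (i - 1)))\<^sup>2 \<le> 2 * \<eta>\<^sup>2 * (Q + (norm (?B i))\<^sup>2)" if i: "i \<in> {1..n}" for i
  proof -
    let ?A = "(\<Sum>j=i..n. e j) /\<^sub>R real n"
    \<comment> \<open>Cauchy-Schwarz over at most \<open>n\<close> terms; the bound is the same for
      all \<open>i\<close>.\<close>
    have A: "(norm ?A)\<^sup>2 \<le> Q"
    proof -
      have "(norm (\<Sum>j=i..n. e j))\<^sup>2 \<le> real (card {i..n}) * (\<Sum>j=i..n. (norm (e j))\<^sup>2)"
        by (rule norm_sum_squared_le)
      also have "\<dots> \<le> real n * (\<Sum>j=1..n. (norm (e j))\<^sup>2)"
        using i by (intro mult_mono sum_mono2) (auto simp: sum_nonneg)
      finally have "(norm (\<Sum>j=i..n. e j))\<^sup>2 / (real n)\<^sup>2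
          \<le> real n * (\<Sum>j=1..n. (norm (e j))\<^sup>2) / (real n)\<^sup>2"
        by (rule divide_right_mono) simp
      also have "\<dots> = Q"
        using n by (simp add: Q_def e_def power2_eq_square[of "real n"])
      also have "(norm (\<Sum>j=i..n. e j))\<^sup>2 / (real n)\<^sup>2 = (norm ?A)\<^sup>2"
        by (simp add: power_mult_distrib power_inverse divide_inverse mult.commute)
      finally show ?thesis .
    qed
    have "{1..n} = {1..i - 1} \<union> {i..n}" using i by auto
    then have "(\<Sum>j=1..n. h j) = (\<Sum>j=1..i - 1. h j) + (\<Sum>j=i..n. h j)" for h :: "nat \<Rightarrow> 'a"
      using sum.union_disjoint[of "{1..i - 1}" "{i..n}" h] i by auto
    then have "w n - w (i - 1) = - (\<Sum>j=i..n. (\<eta> / real n) *\<^sub>R g (p j) (w (j - 1)))"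
      unfolding w_def by (subst (1 2) nasg_inner_eq) simp
    also have "\<dots> = - (\<eta> *\<^sub>R (?A + ?B i))"
      by (simp add: e_def sum_subtractf scaleR_sum_right[symmetric] scaleR_add_right[symmetric]
          divide_inverse)
    finally have "(norm (w n - w (i - 1)))\<^sup>2 = \<eta>\<^sup>2 * (norm (?A + ?B i))\<^sup>2"
      by (simp add: power_mult_distrib)
    also have "\<dots> \<le> \<eta>\<^sup>2 * (2 * (norm ?A)\<^sup>2 + 2 * (norm (?B i))\<^sup>2)"
      by (intro mult_left_mono norm_add_squared_le) simp
    also have "\<dots> \<le> \<eta>\<^sup>2 * (2 * Q + 2 * (norm (?B i))\<^sup>2)"
      using A by (intro mult_left_mono) auto
    finally show ?thesis by (simp add: distrib_left mult_ac)
  qed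
  then have "(\<Sum>i=1..n. (norm (w n - w (i - 1)))\<^sup>2) \<le> (\<Sum>i=1..n. 2 * \<eta>\<^sup>2 * (Q + (norm (?B i))\<^sup>2))"
    by (rule sum_mono)
  also have "\<dots> = 2 * \<eta>\<^sup>2 * (real n * Q + (\<Sum>i=1..n. (norm (?B i))\<^sup>2))"
    by (simp only: sum_distrib_left[symmetric] sum.distrib) simp
  also have "\<dots> = real n * (2 * \<eta>\<^sup>2 * (Q + tail_noise n (\<lambda>i. g i xs) p))"
    using n by (simp add: tail_noise_def distrib_left)
  finally show ?thesis
    using n by (simp add: divide_le_eq mult.commute)
qed

text \<open>
  The step size condition makes the co-coercivity gain
  \<open>- \<theta> / (2 * L) * \<parallel>\<nabla>f(w; i) - \<nabla>f(xs; i)\<parallel>\<^sup>2\<close> pay for the displacement within the epoch, so that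
  only the gradient noise at the minimizer remains.
\<close>

lemma epoch_descent:
  assumes y: "y \<in> S" and x: "x \<in> S" and p: "p permutes {1..n}"
    and \<theta>: "0 \<le> \<theta>" "\<theta> \<le> 1" and step: "2 * (L * \<eta>)\<^sup>2 \<le> \<theta>"
  defines "x' \<equiv> nasg_inner g (\<lambda>_. \<eta> / real n) p y n"
  shows "gap x' \<le> (1 - \<theta>) * gap x
    + epoch_gradient \<eta> p y \<bullet> (x' - (1 - \<theta>) *\<^sub>R x - \<theta> *\<^sub>R xs)
    + L * \<eta>\<^sup>2 * tail_noise n (\<lambda>i. g i xs) p"
proof -
  define w where "w = nasg_inner g (\<lambda>_. \<eta> / real n) p y"
  define q where "q i = (norm (g (p i) (w (i - 1)) - g (p i) xs))\<^sup>2" for i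
  define r where "r i = (norm (w n - w (i - 1)))\<^sup>2" for i
  define c where "c = x' - (1 - \<theta>) *\<^sub>R x - \<theta> *\<^sub>R xs"
  define Q where "Q = (\<Sum>i=1..n. q i) / real n"
  define R where "R = (\<Sum>i=1..n. r i) / real n"
  have w: "i \<le> n \<Longrightarrow> w i \<in> S" for i
    unfolding w_def by (rule nasg_inner_mem[OF y p])
  have x'w: "x' = w n" by (simp add: x'_def w_def)
  \<comment> \<open>The three-point inequality with reference \<open>x\<close> gets weight
    \<open>1 - \<theta>\<close> and its gain is dropped; with reference \<open>xs\<close> it gets
    weight \<open>\<theta>\<close> and the gain is kept.\<close>
  have pw: "f (p i) x' - f (p i) xs \<le> (1 - \<theta>) * (f (p i) x - f (p i) xs)
      + g (p i) (w (i - 1)) \<bullet> c + L / 2 * r i - \<theta> / (2 * L) * q i" if i: "i \<in> {1..n}" for i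
  proof -
    have pi: "p i \<in> {1..n}" using permutes_in_image[OF p] i by blast
    have wi: "w (i - 1) \<in> S" "x' \<in> S" using w i x'w by auto
    let ?g = "g (p i) (w (i - 1))"
    note three = smooth_convex_three_points[OF S wi(1) _ wi(2) L deriv[OF pi] grad_mem[OF pi]
        lip[OF pi] conv[OF pi]]
    have "f (p i) x' \<le> f (p i) x + ?g \<bullet> (x' - x) + L / 2 * r i"
      using three[OF x] L unfolding r_def x'w by (smt (verit) divide_nonneg_pos zero_le_power2)
    then have 1: "(1 - \<theta>) * f (p i) x' \<le> (1 - \<theta>) * (f (p i) x + ?g \<bullet> (x' - x) + L / 2 * r i)"
      using \<theta> by (intro mult_left_mono) auto
    have "f (p i) x' \<le> f (p i) xs + ?g \<bullet> (x' - xs) + L / 2 * r i - q i / (2 * L)"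
      using three[OF xs] unfolding r_def q_def x'w by simp
    then have 2: "\<theta> * f (p i) x' \<le> \<theta> * (f (p i) xs + ?g \<bullet> (x' - xs) + L / 2 * r i - q i / (2 * L))"
      using \<theta> by (intro mult_left_mono) auto
    have 3: "?g \<bullet> c = (1 - \<theta>) * (?g \<bullet> (x' - x)) + \<theta> * (?g \<bullet> (x' - xs))"
      by (simp add: c_def inner_diff_right algebra_simps)
    show ?thesis using 1 2 unfolding 3 by (simp add: algebra_simps diff_divide_distrib)
  qed
  have perm: "(\<Sum>i=1..n. f (p i) u - f (p i) xs) = real n * gap u" for u
    using sum.permute[OF p, of "\<lambda>i. f i u - f i xs"] n by (simp add: gap_def o_def)
  \<comment> \<open>Folding these differences into \<open>h\<close> prevents
    \<open>sum_subtractf\<close> from splitting them below.\<close>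
  define h where "h i = f (p i) x - f (p i) xs" for i
  have nR: "real n * R = (\<Sum>i=1..n. r i)" and nQ: "real n * Q = (\<Sum>i=1..n. q i)"
    using n by (simp_all add: R_def Q_def)
  have "real n * gap x' \<le> (\<Sum>i=1..n. (1 - \<theta>) * (f (p i) x - f (p i) xs)
      + g (p i) (w (i - 1)) \<bullet> c + L / 2 * r i - \<theta> / (2 * L) * q i)"
    unfolding perm[symmetric] by (rule sum_mono) (rule pw)
  also have "\<dots> = (1 - \<theta>) * (real n * gap x) + (\<Sum>i=1..n. g (p i) (w (i - 1))) \<bullet> c
      + L / 2 * (real n * R) - \<theta> / (2 * L) * (real n * Q)"
    unfolding nR nQ perm[symmetric] h_def[symmetric]
    by (simp only: sum.distrib sum_subtractf sum_distrib_left inner_sum_left)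
  also have "(\<Sum>i=1..n. g (p i) (w (i - 1))) = real n *\<^sub>R epoch_gradient \<eta> p y"
    using n by (simp add: epoch_gradient_def w_def)
  also have "(1 - \<theta>) * (real n * gap x) + (real n *\<^sub>R epoch_gradient \<eta> p y) \<bullet> c
      + L / 2 * (real n * R) - \<theta> / (2 * L) * (real n * Q)
    = real n * ((1 - \<theta>) * gap x + epoch_gradient \<eta> p y \<bullet> c + L / 2 * R - \<theta> / (2 * L) * Q)"
    by (simp add: algebra_simps)
  finally have main: "gap x' \<le> (1 - \<theta>) * gap x + epoch_gradient \<eta> p y \<bullet> c
      + L / 2 * R - \<theta> / (2 * L) * Q"
    using n by simp
  \<comment> \<open>By \<open>step\<close>, the \<open>Q\<close> part of the displacement is at most
    the co-coercivity gain \<open>\<theta> / (2 * L) * Q\<close>.\<close>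
  have "L / 2 * R \<le> L / 2 * (2 * \<eta>\<^sup>2 * (Q + tail_noise n (\<lambda>i. g i xs) p))"
    using epoch_displacement[of \<eta> p y] L unfolding R_def r_def Q_def q_def w_def
    by (intro mult_left_mono) auto
  also have "\<dots> = (2 * (L * \<eta>)\<^sup>2) / (2 * L) * Q + L * \<eta>\<^sup>2 * tail_noise n (\<lambda>i. g i xs) p"
    using L by (simp add: field_simps power2_eq_square)
  also have "(2 * (L * \<eta>)\<^sup>2) / (2 * L) * Q \<le> \<theta> / (2 * L) * Q"
    using step L by (intro mult_right_mono divide_right_mono) (auto simp: Q_def q_def sum_nonneg)
  finally show ?thesis using main unfolding c_def by linarith
qed

text \<open>
  Here \<open>z\<close> is the mirror sequence of Nesterov's method: an epoch moves \<open>z\<close> by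
  \<open>- (\<eta> / \<theta>) G\<close> with \<open>\<theta> = 2 / (t + 2)\<close>, where \<open>G\<close> is the mean of the gradients used in it.
\<close>

lemma nasg_potential:
  fixes \<eta> :: "nat \<Rightarrow> real" and \<pi> :: "nat \<Rightarrow> nat \<Rightarrow> nat" and x0 :: 'a
  assumes x0: "x0 \<in> S"
    and \<pi>: "\<And>t. t \<in> {1..T} \<Longrightarrow> \<pi> t permutes {1..n}"
    and \<eta>_pos: "\<And>t. \<eta> t > 0" and \<eta>_mono: "\<And>t. \<eta> t \<le> \<eta> (Suc t)"
    and step: "\<And>t. t \<in> {1..T} \<Longrightarrow> (L * \<eta> t)\<^sup>2 \<le> 1 / (real t + 1)"
  defines "run \<equiv> nasg n g nasg_gamma (\<lambda>t i. \<eta> t / real n) \<pi> x0 x0"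
  defines "z \<equiv> (\<lambda>t. fst (run t) + ((real t + 2) / 2) *\<^sub>R (snd (run t) - fst (run t)))"
  shows "t \<le> T \<Longrightarrow> fst (run t) \<in> S \<and> snd (run t) \<in> S \<and>
    real t * (real t + 2) / 4 * gap (fst (run t)) + (norm (z t - xs))\<^sup>2 / (2 * \<eta> (Suc t))
    \<le> (norm (x0 - xs))\<^sup>2 / (2 * \<eta> 1)
      + (\<Sum>s=1..t. L * (\<eta> s)\<^sup>2 * (real s + 1)\<^sup>2 / 4 * tail_noise n (\<lambda>i. g i xs) (\<pi> s))"
proof (induction t)
  case 0
  then show ?case using x0 by (simp add: run_def z_def)
next
  case (Suc t)
  obtain x y where xy: "run t = (x, y)" by fastforce
  let ?e = "\<eta> (Suc t)" and ?p = "\<pi> (Suc t)"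
  define x' where "x' = nasg_inner g (\<lambda>_. ?e / real n) ?p y n"
  define G where "G = epoch_gradient ?e ?p y"
  define V where "V = tail_noise n (\<lambda>i. g i xs) ?p"
  \<comment> \<open>\<open>\<tau>\<close> is \<open>1 / \<theta>\<close> for epoch
    \<open>Suc t\<close>; it equals 1 in the first epoch.\<close>
  define \<tau> where "\<tau> = (real t + 2) / 2"
  define u where "u = z t - xs"
  define u' where "u' = z (Suc t) - xs"
  have \<tau>: "\<tau> \<ge> 1" by (simp add: \<tau>_def)
  from Suc xy have mem: "x \<in> S" "y \<in> S" by auto
  have p: "?p permutes {1..n}" using Suc.prems by (intro \<pi>) auto
  have x'S: "x' \<in> S" unfolding x'_def using nasg_inner_mem[OF mem(2) p] by simp
  have run': "run (Suc t) = (x', x' + nasg_gamma (Suc t) *\<^sub>R (x' - x))"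
    using xy by (simp add: run_def x'_def Let_def)
  have x'G: "x' = y - ?e *\<^sub>R G"
    unfolding x'_def G_def by (rule nasg_inner_epoch)
  have zt: "z t = x + \<tau> *\<^sub>R (y - x)"
    by (simp add: z_def xy \<tau>_def)
  \<comment> \<open>Here \<open>nasg_gamma (Suc t) = t / (t + 3)\<close>. This momentum makes the
    new mirror point the extrapolation from \<open>x\<close> through \<open>x'\<close> by the factor
    \<open>\<tau>\<close>.\<close>
  have "(real (Suc t) + 2) / 2 * nasg_gamma (Suc t) = \<tau> - 1"
    by (simp add: nasg_gamma_def \<tau>_def field_simps)
  moreover have "z (Suc t) = x' + ((real (Suc t) + 2) / 2 * nasg_gamma (Suc t)) *\<^sub>R (x' - x)"
    by (simp add: z_def run')
  ultimately have "z (Suc t) = x' + (\<tau> - 1) *\<^sub>R (x' - x)"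
    by (simp only:)
  then have zt': "z (Suc t) = x + \<tau> *\<^sub>R (x' - x)"
    by (simp add: algebra_simps)
  have u': "u' = u - (\<tau> * ?e) *\<^sub>R G"
    unfolding u_def u'_def zt zt' x'G by (simp add: algebra_simps)
  \<comment> \<open>Hence the linear term in the epoch bound pairs \<open>G\<close> with the new
    mirror error \<open>u'\<close>.\<close>
  have c: "x' - (1 - 1 / \<tau>) *\<^sub>R x - (1 / \<tau>) *\<^sub>R xs = (1 / \<tau>) *\<^sub>R u'"
    unfolding u'_def zt' using \<tau> by (simp add: algebra_simps)
  have "2 * (L * ?e)\<^sup>2 \<le> 1 / \<tau>"
    using step[of "Suc t"] Suc.prems by (simp add: \<tau>_def field_simps)
  from epoch_descent[OF mem(2,1) p _ _ this] \<tau>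
  have "gap x' \<le> (1 - 1 / \<tau>) * gap x + G \<bullet> (x' - (1 - 1 / \<tau>) *\<^sub>R x - (1 / \<tau>) *\<^sub>R xs)
      + L * ?e\<^sup>2 * V"
    unfolding x'_def G_def V_def by simp
  then have "gap x' \<le> (1 - 1 / \<tau>) * gap x + (1 / \<tau>) * (G \<bullet> u') + L * ?e\<^sup>2 * V"
    unfolding c by simp
  \<comment> \<open>After scaling by \<open>\<tau>\<^sup>2\<close> the old gap has weight
    \<open>\<tau>\<^sup>2 - \<tau> = t (t + 2) / 4\<close>, exactly its weight in the
    potential.\<close>
  then have "\<tau>\<^sup>2 * gap x' \<le> \<tau>\<^sup>2 * ((1 - 1 / \<tau>) * gap x + (1 / \<tau>) * (G \<bullet> u') + L * ?e\<^sup>2 * V)"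
    by (rule mult_left_mono) simp
  also have "\<dots> = (\<tau>\<^sup>2 - \<tau>) * gap x + \<tau> * (G \<bullet> u') + L * ?e\<^sup>2 * \<tau>\<^sup>2 * V"
    using \<tau> by (simp add: field_simps power2_eq_square)
  finally have desc: "\<tau>\<^sup>2 * gap x' \<le> (\<tau>\<^sup>2 - \<tau>) * gap x + \<tau> * (G \<bullet> u') + L * ?e\<^sup>2 * \<tau>\<^sup>2 * V" .
  \<comment> \<open>Expanding \<open>u\<close> around the new error \<open>u'\<close> leaves the
    squared \<open>G\<close> term with a sign that allows it to be dropped.\<close>
  have "u = u' + (\<tau> * ?e) *\<^sub>R G" by (simp add: u')
  then have "(norm u)\<^sup>2 = (norm u')\<^sup>2 + 2 * ?e * (\<tau> * (G \<bullet> u')) + (norm ((\<tau> * ?e) *\<^sub>R G))\<^sup>2"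
    by (simp only: power2_norm_eq_inner)
      (simp add: inner_add_left inner_add_right inner_commute algebra_simps)
  then have "2 * ?e * (\<tau> * (G \<bullet> u')) \<le> (norm u)\<^sup>2 - (norm u')\<^sup>2" by simp
  then have "\<tau> * (G \<bullet> u') \<le> (norm u)\<^sup>2 / (2 * ?e) - (norm u')\<^sup>2 / (2 * ?e)"
    using \<eta>_pos[of "Suc t"] by (simp add: field_simps)
  moreover have "(norm u')\<^sup>2 / (2 * \<eta> (Suc (Suc t))) \<le> (norm u')\<^sup>2 / (2 * ?e)"
    using \<eta>_pos[of "Suc t"] \<eta>_mono[of "Suc t"] by (intro divide_left_mono) auto
  \<comment> \<open>The new weight \<open>(t + 1) (t + 3) / 4\<close> falls short of
    \<open>\<tau>\<^sup>2\<close> by \<open>1 / 4\<close>; nonnegativity of the gap permits the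
    loss.\<close>
  moreover have "real (Suc t) * (real (Suc t) + 2) / 4 * gap x' \<le> \<tau>\<^sup>2 * gap x'"
    by (intro mult_right_mono gap_nonneg x'S) (simp add: \<tau>_def field_simps power2_eq_square)
  moreover have "\<tau>\<^sup>2 - \<tau> = real t * (real t + 2) / 4"
    by (simp add: \<tau>_def field_simps power2_eq_square)
  moreover have "L * ?e\<^sup>2 * \<tau>\<^sup>2 * V = L * ?e\<^sup>2 * (real (Suc t) + 1)\<^sup>2 / 4 * V"
    by (simp add: \<tau>_def power_divide algebra_simps)
  moreover have "real t * (real t + 2) / 4 * gap x + (norm u)\<^sup>2 / (2 * ?e)
    \<le> (norm (x0 - xs))\<^sup>2 / (2 * \<eta> 1)
      + (\<Sum>s=1..t. L * (\<eta> s)\<^sup>2 * (real s + 1)\<^sup>2 / 4 * tail_noise n (\<lambda>i. g i xs) (\<pi> s))"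
    using Suc xy by (simp add: u_def)
  ultimately have "real (Suc t) * (real (Suc t) + 2) / 4 * gap x'
      + (norm u')\<^sup>2 / (2 * \<eta> (Suc (Suc t)))
    \<le> (norm (x0 - xs))\<^sup>2 / (2 * \<eta> 1)
      + (\<Sum>s=1..t. L * (\<eta> s)\<^sup>2 * (real s + 1)\<^sup>2 / 4 * tail_noise n (\<lambda>i. g i xs) (\<pi> s))
      + L * ?e\<^sup>2 * (real (Suc t) + 1)\<^sup>2 / 4 * V"
    using desc by (smt (verit))
  moreover have "x' + nasg_gamma (Suc t) *\<^sub>R (x' - x) \<in> S"
    using S x'S mem by (intro subspace_add subspace_scale subspace_diff)
  ultimately show ?case
    using x'S unfolding run' u'_def V_def by simp
qed

end

section \<open>Step sizes and the convergence rate\<close>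

lemma root_3_12_bounds: "2 \<le> root 3 12" "root 3 12 \<le> 3"
proof -
  have "root 3 (2 ^ 3) \<le> root 3 12" "root 3 12 \<le> root 3 (3 ^ 3)"
    by (rule real_root_le_mono; simp)+
  then show "2 \<le> root 3 12" "root 3 12 \<le> 3"
    by (simp_all only: real_root_power_cancel zero_less_numeral zero_le_numeral)
qed

lemma nasg_alpha_ge_1: "nasg_alpha T \<ge> 1"
  by (simp add: nasg_alpha_def)

lemma nasg_k_pos: "nasg_k T > 0"
  using nasg_alpha_ge_1[of T] by (simp add: nasg_k_def)

lemma nasg_eta_pos: "L > 0 \<Longrightarrow> T \<ge> 1 \<Longrightarrow> nasg_eta L T t > 0"
  using nasg_alpha_ge_1[of T] nasg_k_pos[of T] by (simp add: nasg_eta_def)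

lemma nasg_eta_mono: "L > 0 \<Longrightarrow> nasg_eta L T t \<le> nasg_eta L T (Suc t)"
  using nasg_alpha_ge_1[of T] nasg_k_pos[of T] unfolding nasg_eta_def
  by (intro divide_right_mono mult_left_mono) auto

text \<open>At \<open>t = 1\<close> the factor \<open>\<alpha>\<close> cancels against the one in
  \<open>k\<close>, and both \<open>e\<close> and the cube root of 12 are at most 3.\<close>

lemma nasg_eta_1:
  assumes "L > 0" "T \<ge> 1"
  shows "1 / nasg_eta L T 1 \<le> 9 * L * real T"
proof -
  have "nasg_eta L T 1 = 1 / (exp 1 * root 3 12 * (L * real T))"
    using nasg_alpha_ge_1[of T] by (simp add: nasg_eta_def nasg_k_def)
  moreover have "exp 1 * root 3 12 \<le> 3 * 3"
    using exp_le root_3_12_bounds by (intro mult_mono) auto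
  ultimately show ?thesis
    using assms by (simp add: mult.assoc[symmetric] mult_right_mono)
qed

text \<open>The growth \<open>\<alpha> ^ t\<close> is at most
  \<open>(1 + 1 / T) ^ T \<le> e\<close>, which cancels the \<open>e\<close> in \<open>k\<close>;
  the cube root of 12 being at least 2 leaves the factor \<open>1 / 2\<close>.\<close>

lemma nasg_eta_le:
  assumes "L > 0" "T \<ge> 1" "t \<le> T"
  shows "L * nasg_eta L T t \<le> 1 / (2 * real T)"
proof -
  have "nasg_alpha T ^ t \<le> nasg_alpha T ^ T"
    using nasg_alpha_ge_1 assms by (intro power_increasing)
  also have "\<dots> \<le> exp (1 / real T) ^ T"
    unfolding nasg_alpha_def by (intro power_mono) auto
  also have "\<dots> = exp 1"
    using assms by (simp flip: exp_of_nat_mult)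
  finally have "nasg_alpha T ^ t \<le> exp 1" .
  moreover have "nasg_k T \<le> 1 / (exp 1 * 1 * 2)"
    unfolding nasg_k_def using nasg_alpha_ge_1[of T] root_3_12_bounds
    by (intro divide_left_mono mult_mono) auto
  ultimately have "nasg_k T * nasg_alpha T ^ t \<le> 1 / (exp 1 * 1 * 2) * exp 1"
    using nasg_alpha_ge_1[of T] by (intro mult_mono) auto
  then have "nasg_k T * nasg_alpha T ^ t / real T \<le> (1 / 2) / real T"
    by (intro divide_right_mono) auto
  then show ?thesis using assms by (simp add: nasg_eta_def)
qed

text \<open>Pathwise rate: the potential bound at \<open>t = T\<close>, without its distance term on
  the left, divided by \<open>T (T + 2) / 4\<close>. The 18 is \<open>9 / 2 * 4\<close>, with 9 from
  the bound on \<open>1 / nasg_eta L T 1\<close>.\<close>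

lemma (in smooth_convex_sum) nasg_gap_le:
  fixes x0 :: 'a
  assumes x0: "x0 \<in> S" and T: "T \<ge> 1"
    and \<pi>: "\<And>t. t \<in> {1..T} \<Longrightarrow> \<pi> t permutes {1..n}"
  shows "gap (fst (nasg n g nasg_gamma (\<lambda>t i. nasg_eta L T t / real n) \<pi> x0 x0 T))
    \<le> 18 * L * (norm (x0 - xs))\<^sup>2 / real T
      + (\<Sum>s=1..T. tail_noise n (\<lambda>i. g i xs) (\<pi> s)) / (L * (real T)\<^sup>2)"
    (is "?gap \<le> _ + ?V / _")
proof -
  let ?\<eta> = "nasg_eta L T" and ?N = "\<lambda>s. tail_noise n (\<lambda>i. g i xs) (\<pi> s)"
  let ?D = "(norm (x0 - xs))\<^sup>2"
  have \<eta>_pos: "?\<eta> t > 0" for t using L T by (rule nasg_eta_pos)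
  have sq: "(L * ?\<eta> t)\<^sup>2 \<le> 1 / (4 * (real T)\<^sup>2)" if "t \<le> T" for t
  proof -
    have "(L * ?\<eta> t)\<^sup>2 \<le> (1 / (2 * real T))\<^sup>2"
      using nasg_eta_le[OF L T that] \<eta>_pos[of t] L by (intro power_mono) auto
    then show ?thesis by (simp add: power_divide)
  qed
  have "1 \<le> real T" using T by simp
  then have "real T + 1 \<le> 4 * (real T)\<^sup>2"
    using self_le_power[of "real T" 2] by linarith
  then have step: "(L * ?\<eta> t)\<^sup>2 \<le> 1 / (real t + 1)" if "t \<in> {1..T}" for t
    using sq[of t] that T frac_le[of 1 1 "real t + 1" "4 * (real T)\<^sup>2"] by auto
  \<comment> \<open>A weight independent of \<open>s\<close>, from
    \<open>L * ?\<eta> s \<le> 1 / (2 T)\<close> and \<open>s \<le> T\<close>.\<close>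
  have noise: "L * (?\<eta> s)\<^sup>2 * (real s + 1)\<^sup>2 / 4 * ?N s
      \<le> (real T + 1)\<^sup>2 / (16 * (L * (real T)\<^sup>2)) * ?N s" if s: "s \<in> {1..T}" for s
  proof (rule mult_right_mono)
    have "L * (?\<eta> s)\<^sup>2 * (real s + 1)\<^sup>2 / 4 = (L * ?\<eta> s)\<^sup>2 * (real s + 1)\<^sup>2 / (4 * L)"
      using L by (simp add: power_mult_distrib power2_eq_square)
    also have "\<dots> \<le> 1 / (4 * (real T)\<^sup>2) * (real T + 1)\<^sup>2 / (4 * L)"
      using sq[of s] s L by (intro divide_right_mono mult_mono power_mono) auto
    also have "\<dots> = (real T + 1)\<^sup>2 / (16 * (L * (real T)\<^sup>2))" by simp
    finally show "L * (?\<eta> s)\<^sup>2 * (real s + 1)\<^sup>2 / 4 \<le> (real T + 1)\<^sup>2 / (16 * (L * (real T)\<^sup>2))" .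
    show "0 \<le> ?N s" by (rule tail_noise_nonneg)
  qed
  have V: "?V \<ge> 0" by (intro sum_nonneg tail_noise_nonneg)
  have T2: "(real T + 1)\<^sup>2 / 16 \<le> real T * (real T + 2) / 4"
  proof -
    have "0 \<le> real T * (real T * 12)" by simp
    with \<open>1 \<le> real T\<close> have "4 \<le> real T * 24 + real T * (real T * 12)" by linarith
    then show ?thesis by (simp add: power2_eq_square field_simps)
  qed
  have "?D / (2 * ?\<eta> 1) \<le> 9 * L * real T * ?D / 2"
    using mult_right_mono[OF nasg_eta_1[OF L T], of "?D / 2"] by (simp add: field_simps)
  also have "\<dots> \<le> real T * (real T + 2) / 4 * (18 * L * ?D / real T)"
    using T L by (simp add: field_simps)
  finally have start: "?D / (2 * ?\<eta> 1) \<le> real T * (real T + 2) / 4 * (18 * L * ?D / real T)" .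
  have pot: "real T * (real T + 2) / 4 * ?gap
      \<le> ?D / (2 * ?\<eta> 1) + (\<Sum>s=1..T. L * (?\<eta> s)\<^sup>2 * (real s + 1)\<^sup>2 / 4 * ?N s)"
    by (rule order_trans[OF _ nasg_potential[OF x0 \<pi> \<eta>_pos nasg_eta_mono[OF L] step order_refl,
        THEN conjunct2, THEN conjunct2]]) (simp_all add: \<eta>_pos less_imp_le)
  have "(\<Sum>s=1..T. L * (?\<eta> s)\<^sup>2 * (real s + 1)\<^sup>2 / 4 * ?N s)
      \<le> (\<Sum>s=1..T. (real T + 1)\<^sup>2 / (16 * (L * (real T)\<^sup>2)) * ?N s)"
    by (rule sum_mono) (rule noise)
  also have "\<dots> = (real T + 1)\<^sup>2 / 16 * (?V / (L * (real T)\<^sup>2))"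
    by (simp only: sum_distrib_left[symmetric]) simp
  also have "\<dots> \<le> real T * (real T + 2) / 4 * (?V / (L * (real T)\<^sup>2))"
    using V L by (intro mult_right_mono T2) auto
  finally have "real T * (real T + 2) / 4 * ?gap
      \<le> real T * (real T + 2) / 4 * (18 * L * ?D / real T)
        + real T * (real T + 2) / 4 * (?V / (L * (real T)\<^sup>2))"
    by (rule order_trans[OF pot add_mono[OF start]])
  then have "real T * (real T + 2) / 4 * ?gap
      \<le> real T * (real T + 2) / 4 * (18 * L * ?D / real T + ?V / (L * (real T)\<^sup>2))"
    by (simp only: distrib_left[of "real T * (real T + 2) / 4"])
  moreover have "real T * (real T + 2) / 4 > 0" using T by simp
  ultimately show ?thesis by (simp only: mult_le_cancel_left_pos)
qed

text \<open>By linearity only the marginal law of each epoch matters. Each of the \<open>T\<close>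
  noise terms contributes at most the sum of squared gradient norms at \<open>xs\<close> over
  \<open>n\<^sup>2\<close>, so one factor \<open>n T\<close> remains in the denominator.\<close>

lemma (in smooth_convex_sum) expectation_nasg_gap_le:
  fixes x0 :: 'a
  assumes x0: "x0 \<in> S" and T: "T \<ge> 1"
    and P: "P \<in> {random_reshuffling n T, single_shuffling n}"
  shows "measure_pmf.expectation P (\<lambda>\<pi>.
      gap (fst (nasg n g nasg_gamma (\<lambda>t i. nasg_eta L T t / real n) \<pi> x0 x0 T)))
    \<le> 18 * L * (norm (x0 - xs))\<^sup>2 / real T
      + (\<Sum>i=1..n. (norm (g i xs))\<^sup>2) / real n / (L * real (n * T))"
proof -
  let ?D = "18 * L * (norm (x0 - xs))\<^sup>2 / real T" and ?N = "tail_noise n (\<lambda>i. g i xs)"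
  let ?s = "(\<Sum>i=1..n. (norm (g i xs))\<^sup>2)"
  have int: "integrable (measure_pmf P) h" for h :: "(nat \<Rightarrow> nat \<Rightarrow> nat) \<Rightarrow> real"
    by (rule integrable_measure_pmf_finite[OF finite_set_scheme[OF P]])
  have "measure_pmf.expectation P (\<lambda>\<pi>.
      gap (fst (nasg n g nasg_gamma (\<lambda>t i. nasg_eta L T t / real n) \<pi> x0 x0 T)))
    \<le> measure_pmf.expectation P (\<lambda>\<pi>. ?D + (\<Sum>t=1..T. ?N (\<pi> t)) / (L * (real T)\<^sup>2))"
    using nasg_gap_le[OF x0 T] scheme_permutes[OF P]
    by (intro integral_mono_AE int) (auto simp: AE_measure_pmf_iff)
  also have "\<dots> = ?D + (\<Sum>t=1..T. measure_pmf.expectation P (\<lambda>\<pi>. ?N (\<pi> t))) / (L * (real T)\<^sup>2)"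
    by (simp add: int Bochner_Integration.integral_add Bochner_Integration.integral_sum)
  also have "(\<Sum>t=1..T. measure_pmf.expectation P (\<lambda>\<pi>. ?N (\<pi> t))) \<le> (\<Sum>t=1..T. ?s / (real n)\<^sup>2)"
  proof (rule sum_mono)
    fix t assume "t \<in> {1..T}"
    from scheme_marginal[OF P this]
    have "measure_pmf.expectation P (\<lambda>\<pi>. ?N (\<pi> t)) = measure_pmf.expectation (uniform_permutation {1..n}) ?N"
      by (metis integral_map_pmf)
    with expectation_tail_noise[OF sum_gradients_minimizer]
    show "measure_pmf.expectation P (\<lambda>\<pi>. ?N (\<pi> t)) \<le> ?s / (real n)\<^sup>2" by simp
  qed
  also have "(\<Sum>t=1..T. ?s / (real n)\<^sup>2) / (L * (real T)\<^sup>2) = ?s / real n / (L * real (n * T))"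
    using T by (simp add: power2_eq_square)
  finally show ?thesis using L by (simp add: divide_right_mono)
qed

theorem corollaryD3:
  shows "\<exists>C>0. \<forall>(d::nat) (n::nat) (L::real) (f :: nat \<Rightarrow> fsvec \<Rightarrow> real) (xs::fsvec)
      (x0::fsvec) (\<epsilon>::real) (T::nat).
    L > 0 \<and> n \<ge> 1
    \<and> (\<forall>i\<in>{1..n}. convex_on (Rd d) (f i))
    \<and> (\<forall>i\<in>{1..n}. f i differentiable_on Rd d)
    \<and> (\<forall>i\<in>{1..n}. \<forall>x\<in>Rd d. \<forall>y\<in>Rd d.
          norm (grad d (f i) x - grad d (f i) y) \<le> L * norm (x - y))
    \<and> xs \<in> Rd d \<and> (\<forall>x\<in>Rd d. avg_fun n f xs \<le> avg_fun n f x)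
    \<and> \<epsilon> > 0 \<and> x0 \<in> Rd d \<and> T \<ge> 2
    \<longrightarrow> (\<forall>t\<in>{1..T}. nasg_eta L T t \<le> 1 / L)
      \<and> (real (n * T) \<ge> C * (sigma_sq d n f xs / (L * \<epsilon>) + real n * L * (norm (x0 - xs))\<^sup>2 / \<epsilon>)
          \<longrightarrow> (\<forall>P\<in>{random_reshuffling n T, single_shuffling n}.
                measure_pmf.expectation P (\<lambda>\<pi>.
                  avg_fun n f (fst (nasg n (\<lambda>i. grad d (f i)) nasg_gamma
                    (\<lambda>t i. nasg_eta L T t / real n) \<pi> x0 x0 T)) - avg_fun n f xs) \<le> \<epsilon>))"
\<comment> \<open>The constant is the coefficient of the distance term in the rate; the noise term
  has coefficient 1.\<close>
proof (intro exI[of _ "18::real"] conjI allI impI ballI; (elim conjE)?)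
  fix d n :: nat and L :: real and f :: "nat \<Rightarrow> fsvec \<Rightarrow> real" and xs x0 :: fsvec
    and \<epsilon> :: real and T t :: nat
  assume "L > 0" "T \<ge> 2" "t \<in> {1..T}"
  then have "L * nasg_eta L T t \<le> 1 / (2 * real T)"
    by (intro nasg_eta_le) auto
  also have "\<dots> \<le> 1" using \<open>T \<ge> 2\<close> by simp
  finally show "nasg_eta L T t \<le> 1 / L"
    using \<open>L > 0\<close> by (simp add: field_simps)
next
  fix d n :: nat and L :: real and f :: "nat \<Rightarrow> fsvec \<Rightarrow> real" and xs x0 :: fsvec
    and \<epsilon> :: real and T :: nat and P
  assume L: "L > 0" and n: "n \<ge> 1" and xs: "xs \<in> Rd d" and x0: "x0 \<in> Rd d"
    and conv: "\<forall>i\<in>{1..n}. convex_on (Rd d) (f i)"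
    and diff: "\<forall>i\<in>{1..n}. f i differentiable_on Rd d"
    and lip: "\<forall>i\<in>{1..n}. \<forall>x\<in>Rd d. \<forall>y\<in>Rd d.
          norm (grad d (f i) x - grad d (f i) y) \<le> L * norm (x - y)"
    and min: "\<forall>x\<in>Rd d. avg_fun n f xs \<le> avg_fun n f x"
    and \<epsilon>: "\<epsilon> > 0" and T: "T \<ge> 2"
    and nT: "18 * (sigma_sq d n f xs / (L * \<epsilon>) + real n * L * (norm (x0 - xs))\<^sup>2 / \<epsilon>) \<le> real (n * T)"
    and P: "P \<in> {random_reshuffling n T, single_shuffling n}"
  interpret smooth_convex_sum "Rd d" n L f "\<lambda>i. grad d (f i)" xs
  proof
    show "(f i has_derivative (\<bullet>) (grad d (f i) x)) (at x within Rd d)"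
      and "grad d (f i) x \<in> Rd d" if "i \<in> {1..n}" "x \<in> Rd d" for i x
      using grad_works[OF that(2), of "f i"] diff that by (auto simp: differentiable_on_def)
    show "(\<Sum>i=1..n. f i xs) \<le> (\<Sum>i=1..n. f i x)" if "x \<in> Rd d" for x
      using min that n by (auto simp: avg_fun_def divide_le_cancel)
  qed (use L n conv lip xs subspace_Rd in auto)
  have gap: "avg_fun n f u - avg_fun n f xs = gap u" for u
    by (simp add: avg_fun_def gap_def sum_subtractf diff_divide_distrib)
  let ?\<sigma> = "sigma_sq d n f xs" and ?D = "(norm (x0 - xs))\<^sup>2"
  have \<sigma>: "?\<sigma> \<ge> 0" by (simp add: sigma_sq_def sum_nonneg)
  have "measure_pmf.expectation P (\<lambda>\<pi>. gap (fst (nasg n (\<lambda>i. grad d (f i)) nasg_gamma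
      (\<lambda>t i. nasg_eta L T t / real n) \<pi> x0 x0 T))) \<le> 18 * L * ?D / real T + ?\<sigma> / (L * real (n * T))"
    using expectation_nasg_gap_le[OF x0 _ P] T by (simp add: sigma_sq_def)
  \<comment> \<open>Enlarging the noise coefficient to 18 makes the bound a multiple of the
    expression in \<open>nT\<close>.\<close>
  also have "\<dots> \<le> 18 * L * ?D / real T + 18 * ?\<sigma> / (L * real (n * T))"
    using L \<sigma> by (intro add_left_mono divide_right_mono) auto
  also have "\<dots> = 18 * (?\<sigma> / (L * \<epsilon>) + real n * L * ?D / \<epsilon>) * (\<epsilon> / real (n * T))"
    using L n T \<epsilon> by (simp add: field_simps)
  also have "\<dots> \<le> real (n * T) * (\<epsilon> / real (n * T))"
    using nT \<epsilon> by (intro mult_right_mono) auto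
  also have "\<dots> = \<epsilon>" using n T by simp
  finally show "measure_pmf.expectation P (\<lambda>\<pi>.
      avg_fun n f (fst (nasg n (\<lambda>i. grad d (f i)) nasg_gamma
        (\<lambda>t i. nasg_eta L T t / real n) \<pi> x0 x0 T)) - avg_fun n f xs) \<le> \<epsilon>"
    unfolding gap .
qed simp_all

end
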